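(* Let $(S,\Sigma,\mu)$ be a $\sigma$-finite measure space with $\mu$ a complete positive measure, and let $X$ be a real Banach space such that $X^*$ has the wide Radon-Nikodym property with respect to $\mu$. Let $f\in L^1(\mu,X)$ be a non-zero element. If $T\in L^1(\mu,X)^*$ is a support functional for $f$ (i.e. $T\in J(f)$), then there exists $G\in L^{\infty}(\mu,X^* )$ with $G(s)\in J(f(s))$ for a.e. $s\in Z(f)^c$ such that $$T(g)=\int_{S}G(s)(g(s))\,d\mu(s)\quad\text{for all } g\in L^1(\mu,X).$$
   Context: $L^1(\mu,X)$ is the Lebesgue-Bochner space of (a.e.-equivalence classes of) strongly measurable functions $f:S\to X$ with $\|f\|=\int_S\|f(s)\|\,d\mu(s)<\infty$, and $L^\infty(\mu,X^* )$ is the space of (classes of) strongly measurable, essentially bounded functions $G:S\to X^*$ with the essential supremum norm. Strongly measurable means being an a.e. pointwise limit of simple measurable functions. $Z(f)=\{s\in S: f(s)=0\}$ and $Z(f)^c=S\setminus Z(f)$. For a non-zero element $z$ of a Banach space $Y$, $J(z)=\{\phi\in Y^*:\|\phi\|=1,\ \phi(z)=\|z\|\}$ is the set of support functionals at $z$. Wide Radon-Nikodym property: a Banach space $Y$ has it with respect to the $\sigma$-finite measure $\mu$ if every countably additive vector measure $\nu:\Sigma\to Y$ of bounded variation that is absolutely continuous with respect to $\mu$ (i.e. $\mu(E)=0$ implies $\nu(E)=0$) has a Bochner integrable density, i.e. there is $h\in L^1(\mu,Y)$ with $\nu(E)=\int_E h\,d\mu$ for all $E\in\Sigma$. *)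

theory Defs
  imports "HOL-Analysis.Analysis"
begin

text \<open>
  The Bochner integral of HOL-Analysis is restricted to second countable codomains, but here the
  Banach space and its dual are arbitrary. Strong measurability and the Bochner integral are
  therefore introduced for arbitrary normed codomains, on top of the library's simple functions
  and their integrals.

  Elements of the Lebesgue-Bochner spaces are represented by functions; two representatives denote
  the same element iff they agree almost everywhere. The dual of a Banach space \<open>'x\<close> is the library
  type \<open>'x \<Rightarrow>\<^sub>L real\<close>.
\<close>

definition strongly_measurable :: "'a measure \<Rightarrow> ('a \<Rightarrow> 'b::real_normed_vector) \<Rightarrow> bool" where
  "strongly_measurable M f \<longleftrightarrow>
     (\<exists>u :: nat \<Rightarrow> 'a \<Rightarrow> 'b. (\<forall>n. simple_function M (u n)) \<and>
        (AE s in M. (\<lambda>n. u n s) \<longlonglongrightarrow> f s))"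

definition L1_space :: "'a measure \<Rightarrow> ('a \<Rightarrow> 'b::real_normed_vector) set" where
  "L1_space M = {f. strongly_measurable M f \<and> integrable M (\<lambda>s. norm (f s))}"

definition L1_norm :: "'a measure \<Rightarrow> ('a \<Rightarrow> 'b::real_normed_vector) \<Rightarrow> real" where
  "L1_norm M f = (\<integral>s. norm (f s) \<partial>M)"

definition Linf_space :: "'a measure \<Rightarrow> ('a \<Rightarrow> 'b::real_normed_vector) set" where
  "Linf_space M = {G. strongly_measurable M G \<and> (\<exists>C. AE s in M. norm (G s) \<le> C)}"

text \<open>
  Same clauses as the library's \<^const>\<open>has_bochner_integral\<close>, with strong measurability in place of
  Borel measurability.
\<close>

definition has_strong_bochner_integral ::
    "'a measure \<Rightarrow> ('a \<Rightarrow> 'b::real_normed_vector) \<Rightarrow> 'b \<Rightarrow> bool" where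
  "has_strong_bochner_integral M f x \<longleftrightarrow>
     strongly_measurable M f \<and>
     (\<exists>u :: nat \<Rightarrow> 'a \<Rightarrow> 'b. (\<forall>n. Bochner_Integration.simple_bochner_integrable M (u n)) \<and>
        ((\<lambda>n. \<integral>\<^sup>+s. ennreal (norm (f s - u n s)) \<partial>M) \<longlonglongrightarrow> 0) \<and>
        ((\<lambda>n. Bochner_Integration.simple_bochner_integral M (u n)) \<longlonglongrightarrow> x))"

definition zero_set :: "'a measure \<Rightarrow> ('a \<Rightarrow> 'b::zero) \<Rightarrow> 'a set" where
  "zero_set M f = {s \<in> space M. f s = 0}"

text \<open>The support functionals at \<open>z\<close>; only meaningful for \<open>z \<noteq> 0\<close>.\<close>

definition support_functionals :: "'x::real_normed_vector \<Rightarrow> ('x \<Rightarrow>\<^sub>L real) set" where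
  "support_functionals z = {\<phi>. norm \<phi> = 1 \<and> blinfun_apply \<phi> z = norm z}"

text \<open>
  Bounded linear functionals on the Lebesgue-Bochner space, as functions of representatives. The
  second clause makes such a functional a function of almost-everywhere equivalence classes.
  Values outside \<open>L1_space M\<close> are irrelevant.
\<close>

definition L1_dual :: "'a measure \<Rightarrow> (('a \<Rightarrow> 'x::real_normed_vector) \<Rightarrow> real) set" where
  "L1_dual M = {T.
     (\<forall>g\<in>L1_space M. \<forall>h\<in>L1_space M. T (\<lambda>s. g s + h s) = T g + T h) \<and>
     (\<forall>g\<in>L1_space M. \<forall>h\<in>L1_space M. (AE s in M. g s = h s) \<longrightarrow> T g = T h) \<and>
     (\<forall>c. \<forall>g\<in>L1_space M. T (\<lambda>s. c *\<^sub>R g s) = c * T g) \<and>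
     (\<exists>C. \<forall>g\<in>L1_space M. \<bar>T g\<bar> \<le> C * L1_norm M g)}"

definition L1_dual_norm :: "'a measure \<Rightarrow> (('a \<Rightarrow> 'x::real_normed_vector) \<Rightarrow> real) \<Rightarrow> real" where
  "L1_dual_norm M T = (SUP g\<in>{g \<in> L1_space M. L1_norm M g \<le> 1}. \<bar>T g\<bar>)"

definition L1_support_functionals ::
    "'a measure \<Rightarrow> ('a \<Rightarrow> 'x::real_normed_vector) \<Rightarrow> (('a \<Rightarrow> 'x) \<Rightarrow> real) set" where
  "L1_support_functionals M f = {T \<in> L1_dual M. L1_dual_norm M T = 1 \<and> T f = L1_norm M f}"

text \<open>
  Vector measures are set functions of which only the values on \<open>sets M\<close> matter. Countable
  additivity includes \<open>\<nu> {} = 0\<close>, since a constant series converges only if its terms vanish.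
\<close>

definition vector_measure :: "'a measure \<Rightarrow> ('a set \<Rightarrow> 'y::real_normed_vector) \<Rightarrow> bool" where
  "vector_measure M \<nu> \<longleftrightarrow>
     (\<forall>A :: nat \<Rightarrow> 'a set. range A \<subseteq> sets M \<longrightarrow> disjoint_family A \<longrightarrow>
        (\<lambda>i. \<nu> (A i)) sums \<nu> (\<Union>i. A i))"

definition finite_variation :: "'a measure \<Rightarrow> ('a set \<Rightarrow> 'y::real_normed_vector) \<Rightarrow> bool" where
  "finite_variation M \<nu> \<longleftrightarrow>
     (\<exists>C. \<forall>P. finite P \<longrightarrow> P \<subseteq> sets M \<longrightarrow> partition_on (space M) P \<longrightarrow>
        (\<Sum>E\<in>P. norm (\<nu> E)) \<le> C)"

definition abs_continuous :: "'a measure \<Rightarrow> ('a set \<Rightarrow> 'y::real_normed_vector) \<Rightarrow> bool" where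
  "abs_continuous M \<nu> \<longleftrightarrow> (\<forall>E\<in>sets M. emeasure M E = 0 \<longrightarrow> \<nu> E = 0)"

definition wide_RNP :: "'a measure \<Rightarrow> 'y::banach itself \<Rightarrow> bool" where
  "wide_RNP M (_ :: 'y itself) \<longleftrightarrow>
     (\<forall>\<nu> :: 'a set \<Rightarrow> 'y. vector_measure M \<nu> \<longrightarrow> finite_variation M \<nu> \<longrightarrow> abs_continuous M \<nu> \<longrightarrow>
        (\<exists>h\<in>L1_space M. \<forall>E\<in>sets M.
           has_strong_bochner_integral M (\<lambda>s. indicator E s *\<^sub>R h s) (\<nu> E)))"

end

theory Submission
  imports Defs
begin

text \<open>
  The argument represents every bounded functional \<open>T\<close> on \<open>L\<^sup>1(\<mu>, X)\<close> by a function
  \<open>G \<in> L\<^sup>\<infinity>(\<mu>, X\<^sup>*)\<close> (\<open>L1_dual_representation\<close>), and then reads off from \<open>T f = \<parallel>f\<parallel>\<close> that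
  \<open>G s\<close> supports \<open>f s\<close> (\<open>support_functionals_AE\<close>).

  The measure may be infinite, so \<open>E \<mapsto> T (1\<^sub>E x)\<close> need not be defined for every measurable \<open>E\<close>.
  By \<open>\<sigma>\<close>-finiteness there is a strictly positive integrable weight \<open>w\<close>, and one considers instead
  the set function \<open>\<nu>(E)(x) = T (w 1\<^sub>E x)\<close>, which avoids cutting the space into pieces of finite
  measure. Its values lie in \<open>X\<^sup>*\<close> with \<open>\<parallel>\<nu>(E)\<parallel> \<le> \<parallel>T\<parallel> \<integral>\<^sub>E w d\<mu>\<close>. As \<open>\<nu>\<close> is
  finitely additive, this single domination by a finite measure yields countable additivity, bounded
  variation and absolute continuity, so the Radon-Nikodym property provides a density \<open>h\<close> of \<open>\<nu>\<close>,
  and \<open>G = h / w\<close>.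

  The same domination gives \<open>h s x \<le> \<parallel>T\<parallel> w s\<close> almost everywhere for each fixed \<open>x\<close> in the unit
  ball. Since \<open>h\<close> is essentially separably valued, countably many such \<open>x\<close> compute \<open>\<parallel>h s\<parallel>\<close>, whence
  \<open>\<parallel>G s\<parallel> \<le> \<parallel>T\<parallel>\<close> almost everywhere (\<open>AE_norm_le_if_AE_apply_le\<close>). The formula
  \<open>T g = \<integral> G s (g s) d\<mu>\<close> holds for \<open>g = w 1\<^sub>E x\<close> by the choice of \<open>h\<close>, hence for \<open>g = w v\<close> with \<open>v\<close>
  simple. These are dense (\<open>weighted_simple_dense_L1\<close>) and both sides are continuous in \<open>g\<close>.

  If \<open>T\<close> supports \<open>f\<close>, then \<open>\<parallel>G s\<parallel> \<le> 1\<close> and the integral of the nonnegative function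
  \<open>\<parallel>f s\<parallel> - G s (f s)\<close> is \<open>\<parallel>f\<parallel> - T f = 0\<close>, so \<open>G s (f s) = \<parallel>f s\<parallel>\<close> almost everywhere; where
  \<open>f s \<noteq> 0\<close> this forces \<open>\<parallel>G s\<parallel> = 1\<close>.
\<close>

section \<open>Strong measurability\<close>

text \<open>
  Sequential continuity of \<open>F\<close> is all that the closure properties of strong measurability need: a
  binary operation applied to two simple functions is again simple.
\<close>

lemma strongly_measurable_combine:
  assumes f: "strongly_measurable M f" and g: "strongly_measurable M g"
    and F: "\<And>a b x y. a \<longlonglongrightarrow> x \<Longrightarrow> b \<longlonglongrightarrow> y \<Longrightarrow> (\<lambda>n. F (a n) (b n)) \<longlonglongrightarrow> F x y"
  shows "strongly_measurable M (\<lambda>s. F (f s) (g s))"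
proof -
  obtain u where u: "\<And>n. simple_function M (u n)" "AE s in M. (\<lambda>n. u n s) \<longlonglongrightarrow> f s"
    using f unfolding strongly_measurable_def by auto
  obtain v where v: "\<And>n. simple_function M (v n)" "AE s in M. (\<lambda>n. v n s) \<longlonglongrightarrow> g s"
    using g unfolding strongly_measurable_def by auto
  have "simple_function M (\<lambda>s. F (u n s) (v n s))" for n
    using u(1) v(1) by (rule simple_function_compose2)
  moreover have "AE s in M. (\<lambda>n. F (u n s) (v n s)) \<longlonglongrightarrow> F (f s) (g s)"
    using u(2) v(2) by eventually_elim (rule F)
  ultimately show ?thesis
    unfolding strongly_measurable_def by (intro exI[of _ "\<lambda>n s. F (u n s) (v n s)"] conjI allI)
qed

lemma strongly_measurable_simple: "simple_function M u \<Longrightarrow> strongly_measurable M u"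
  unfolding strongly_measurable_def by (intro exI[of _ "\<lambda>_. u"]) auto

lemma strongly_measurable_borel:
  fixes f :: "'a \<Rightarrow> 'b::{real_normed_vector, second_countable_topology}"
  assumes "f \<in> borel_measurable M"
  shows "strongly_measurable M f"
proof -
  obtain F where "\<forall>i. simple_function M (F i)" "\<forall>x\<in>space M. (\<lambda>i. F i x) \<longlonglongrightarrow> f x"
    using borel_measurable_implies_sequence_metric[OF assms, of 0] by blast
  then show ?thesis
    unfolding strongly_measurable_def by (intro exI[of _ F]) auto
qed

lemma strongly_measurable_add:
  "strongly_measurable M f \<Longrightarrow> strongly_measurable M g \<Longrightarrow> strongly_measurable M (\<lambda>s. f s + g s)"
  by (erule (1) strongly_measurable_combine[where F = "(+)"]) (rule tendsto_add)

lemma strongly_measurable_diff: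
  "strongly_measurable M f \<Longrightarrow> strongly_measurable M g \<Longrightarrow> strongly_measurable M (\<lambda>s. f s - g s)"
  by (erule (1) strongly_measurable_combine[where F = "(-)"]) (rule tendsto_diff)

lemma strongly_measurable_scaleR:
  "strongly_measurable M r \<Longrightarrow> strongly_measurable M f \<Longrightarrow> strongly_measurable M (\<lambda>s. r s *\<^sub>R f s)"
  by (erule (1) strongly_measurable_combine[where F = "(*\<^sub>R)"]) (rule tendsto_scaleR)

lemma strongly_measurable_blinfun_apply:
  "strongly_measurable M h \<Longrightarrow> strongly_measurable M g \<Longrightarrow>
    strongly_measurable M (\<lambda>s. blinfun_apply (h s) (g s))"
  by (erule (1) strongly_measurable_combine[where F = blinfun_apply]) (rule blinfun.tendsto)

lemma strongly_measurable_norm: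
  "strongly_measurable M f \<Longrightarrow> strongly_measurable M (\<lambda>s. norm (f s))"
  by (rule strongly_measurable_combine[where F = "\<lambda>x _. norm x" and f = f and g = f])
     (simp_all add: tendsto_norm)

text \<open>
  The limit of simple functions is known only almost everywhere; completeness of the measure lets
  the exceptional null set be ignored.
\<close>

lemma (in complete_measure) borel_strongly_measurable:
  fixes f :: "'a \<Rightarrow> 'b::{banach, second_countable_topology}"
  assumes "strongly_measurable M f"
  shows "f \<in> borel_measurable M"
proof -
  obtain u where u: "\<And>n. simple_function M (u n)" "AE s in M. (\<lambda>n. u n s) \<longlonglongrightarrow> f s"
    using assms unfolding strongly_measurable_def by auto
  have [measurable]: "u n \<in> borel_measurable M" for n
    using u(1) by (rule borel_measurable_simple_function)
  define g where "g s = lim (\<lambda>n. u n s)" for s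
  have [measurable]: "g \<in> borel_measurable M"
    unfolding g_def by measurable
  have eq: "AE s in M. g s = f s"
    using u(2) unfolding g_def by eventually_elim (rule limI)
  show ?thesis
  proof (rule measurableI)
    fix B :: "'b set" assume [measurable]: "B \<in> sets borel"
    have "AE s in M. s \<in> g -` B \<inter> space M \<longleftrightarrow> s \<in> f -` B \<inter> space M"
      using eq by eventually_elim simp
    then show "f -` B \<inter> space M \<in> sets M"
      by (rule in_sets_AE) auto
  qed simp
qed

section \<open>The Lebesgue-Bochner space\<close>

lemma L1_space_integrable_norm: "g \<in> L1_space M \<Longrightarrow> integrable M (\<lambda>s. norm (g s))"
  by (simp add: L1_space_def)

lemma L1_space_strongly_measurable: "g \<in> L1_space M \<Longrightarrow> strongly_measurable M g"
  by (simp add: L1_space_def)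

context complete_measure
begin

lemma borel_norm_strongly_measurable:
  "strongly_measurable M g \<Longrightarrow> (\<lambda>s. norm (g s)) \<in> borel_measurable M"
  by (rule borel_strongly_measurable) (rule strongly_measurable_norm)

lemma L1_spaceI_bound:
  assumes "strongly_measurable M g" "integrable M b" "AE s in M. norm (g s) \<le> b s"
  shows "g \<in> L1_space M"
proof -
  have "integrable M (\<lambda>s. norm (g s))"
    using assms(2) borel_norm_strongly_measurable[OF assms(1)]
    by (rule Bochner_Integration.integrable_bound) (use assms(3) in eventually_elim, simp)
  then show ?thesis
    using assms(1) by (simp add: L1_space_def)
qed

lemma L1_space_add:
  assumes "g \<in> L1_space M" "h \<in> L1_space M"
  shows "(\<lambda>s. g s + h s) \<in> L1_space M"
proof (rule L1_spaceI_bound)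
  show "strongly_measurable M (\<lambda>s. g s + h s)"
    by (intro strongly_measurable_add L1_space_strongly_measurable assms)
  show "integrable M (\<lambda>s. norm (g s) + norm (h s))"
    by (intro Bochner_Integration.integrable_add L1_space_integrable_norm assms)
  show "AE s in M. norm (g s + h s) \<le> norm (g s) + norm (h s)"
    by (intro AE_I2 norm_triangle_ineq)
qed

lemma L1_space_scaleR:
  assumes "g \<in> L1_space M"
  shows "(\<lambda>s. c *\<^sub>R g s) \<in> L1_space M"
proof (rule L1_spaceI_bound[where b = "\<lambda>s. \<bar>c\<bar> * norm (g s)"])
  show "strongly_measurable M (\<lambda>s. c *\<^sub>R g s)"
    by (intro strongly_measurable_scaleR strongly_measurable_simple
        L1_space_strongly_measurable assms) simp
qed (use L1_space_integrable_norm[OF assms] in auto)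

lemma L1_space_zero: "(\<lambda>s. 0) \<in> L1_space M"
  by (rule L1_spaceI_bound[where b = "\<lambda>_. 0"]) (simp_all add: strongly_measurable_simple)

lemma L1_space_diff:
  assumes "g \<in> L1_space M" "h \<in> L1_space M"
  shows "(\<lambda>s. g s - h s) \<in> L1_space M"
  using L1_space_add[OF assms(1) L1_space_scaleR[OF assms(2), of "-1"]] by simp

lemma L1_space_weighted_simple:
  assumes w: "integrable M w" and v: "simple_function M v"
  shows "(\<lambda>s. w s *\<^sub>R v s) \<in> L1_space M"
proof -
  have "bounded (v ` space M)"
    using simple_functionD(1)[OF v] by (rule finite_imp_bounded)
  then obtain B where B: "\<And>s. s \<in> space M \<Longrightarrow> norm (v s) \<le> B"
    unfolding bounded_iff by auto
  show ?thesis
  proof (rule L1_spaceI_bound[where b = "\<lambda>s. \<bar>w s\<bar> * B"])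
    show "strongly_measurable M (\<lambda>s. w s *\<^sub>R v s)"
      using w v by (intro strongly_measurable_scaleR strongly_measurable_borel
          strongly_measurable_simple) auto
    show "AE s in M. norm (w s *\<^sub>R v s) \<le> \<bar>w s\<bar> * B"
      using B by (auto intro!: mult_left_mono)
  qed (use w in auto)
qed

text \<open>
  The simple functions approximating \<open>g / w\<close> almost everywhere are truncated to norm at most
  \<open>2 \<parallel>g s\<parallel> / w s\<close>. This does not disturb the pointwise limit and provides a dominating function. The
  factor \<open>w\<close> makes every simple function, even a constant on a space of infinite measure, integrable.
\<close>

lemma weighted_simple_dense_L1:
  fixes g :: "'a \<Rightarrow> 'b::real_normed_vector"
  assumes w: "integrable M w" "\<And>s. 0 < w s" and g: "g \<in> L1_space M"
  obtains v where "\<And>n. simple_function M (v n)"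
    and "(\<lambda>n. L1_norm M (\<lambda>s. w s *\<^sub>R v n s - g s)) \<longlonglongrightarrow> 0"
proof -
  have [measurable]: "w \<in> borel_measurable M"
    using w(1) by auto
  have ng[measurable]: "(\<lambda>s. norm (g s)) \<in> borel_measurable M"
    using L1_space_integrable_norm[OF g] by (rule borel_measurable_integrable)
  have "strongly_measurable M (\<lambda>s. inverse (w s) *\<^sub>R g s)"
    by (intro strongly_measurable_scaleR strongly_measurable_borel
        L1_space_strongly_measurable[OF g]) simp
  then obtain u where u: "\<And>n. simple_function M (u n)"
    and lim: "AE s in M. (\<lambda>n. u n s) \<longlonglongrightarrow> inverse (w s) *\<^sub>R g s"
    unfolding strongly_measurable_def by auto
  define v where "v n s = (if norm (u n s) \<le> 2 * (inverse (w s) * norm (g s)) then u n s else 0)"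
    for n s
  have v: "simple_function M (v n)" for n
  proof -
    have "(\<lambda>s. norm (u n s)) \<in> borel_measurable M"
      by (rule borel_measurable_simple_function) (rule simple_function_compose1[OF u])
    then have "{s \<in> space M. norm (u n s) \<le> 2 * (inverse (w s) * norm (g s))} \<in> sets M"
      by measurable
    then show ?thesis
      unfolding v_def by (intro simple_function_If u) auto
  qed
  have v_le: "norm (w s *\<^sub>R v n s) \<le> 2 * norm (g s)" for n s
    using w(2)[of s] by (auto simp: v_def field_simps)
  have v_lim: "AE s in M. (\<lambda>n. norm (w s *\<^sub>R v n s - g s)) \<longlonglongrightarrow> 0"
    using lim
  proof eventually_elim
    case (elim s)
    have "(\<lambda>n. v n s) \<longlonglongrightarrow> inverse (w s) *\<^sub>R g s"
    \<comment> \<open>Where \<open>g\<close> vanishes the truncation bound is not eventually slack, but there it forces \<open>v n s = 0\<close>.\<close>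
    proof (cases "g s = 0")
      case True
      then show ?thesis by (simp add: v_def if_distrib cong: if_cong)
    next
      case False
      have "(\<lambda>n. norm (u n s)) \<longlonglongrightarrow> inverse (w s) * norm (g s)"
        using tendsto_norm[OF elim] w(2)[of s] by simp
      moreover have "inverse (w s) * norm (g s) < 2 * (inverse (w s) * norm (g s))"
        using False w(2)[of s] by simp
      ultimately have "\<forall>\<^sub>F n in sequentially. norm (u n s) < 2 * (inverse (w s) * norm (g s))"
        by (rule order_tendstoD(2))
      then have "\<forall>\<^sub>F n in sequentially. u n s = v n s"
        by eventually_elim (simp add: v_def)
      then show ?thesis
        using elim by (rule Lim_transform_eventually[rotated])
    qed
    from tendsto_norm[OF tendsto_diff[OF tendsto_scaleR[OF tendsto_const[of "w s"] this] tendsto_const[of "g s"]]]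
    show ?case using w(2)[of s] by simp
  qed
  have "(\<lambda>n. \<integral>s. norm (w s *\<^sub>R v n s - g s) \<partial>M) \<longlonglongrightarrow> (\<integral>s. 0 \<partial>M)"
  proof (rule integral_dominated_convergence[where w = "\<lambda>s. 3 * norm (g s)"])
    show "integrable M (\<lambda>s. 3 * norm (g s))"
      using g by (simp add: L1_space_def)
    show "(\<lambda>s. norm (w s *\<^sub>R v n s - g s)) \<in> borel_measurable M" for n
      using L1_space_integrable_norm[OF L1_space_diff[OF L1_space_weighted_simple[OF w(1) v] g]]
      by (rule borel_measurable_integrable)
    show "AE s in M. norm (norm (w s *\<^sub>R v n s - g s)) \<le> 3 * norm (g s)" for n
    proof (intro AE_I2)
      fix s show "norm (norm (w s *\<^sub>R v n s - g s)) \<le> 3 * norm (g s)"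
        using norm_triangle_ineq4[of "w s *\<^sub>R v n s" "g s"] v_le[of s n] by simp
    qed
  qed (use v_lim in auto)
  then show ?thesis
    using v by (intro that[of v]) (auto simp: L1_norm_def)
qed

section \<open>Functionals on the Lebesgue-Bochner space\<close>

text \<open>
  The existence of some bound in the definition of the dual makes the supremum defining the norm
  meaningful, and settles the case \<open>L1_norm M g = 0\<close>, where \<open>g\<close> cannot be normalised.
\<close>

lemma L1_dual_norm_bound:
  fixes T :: "('a \<Rightarrow> 'x::real_normed_vector) \<Rightarrow> real"
  assumes T: "T \<in> L1_dual M" and g: "g \<in> L1_space M"
  shows "\<bar>T g\<bar> \<le> L1_dual_norm M T * L1_norm M g"
proof -
  obtain C where C: "\<And>g. g \<in> L1_space M \<Longrightarrow> \<bar>T g\<bar> \<le> C * L1_norm M g"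
    using T unfolding L1_dual_def by blast
  have nonneg: "0 \<le> L1_norm M h" for h :: "'a \<Rightarrow> 'x"
    by (simp add: L1_norm_def)
  show ?thesis
  proof (cases "L1_norm M g = 0")
    case True
    then show ?thesis using C[OF g] by simp
  next
    case False
    then have pos: "0 < L1_norm M g" using nonneg[of g] by simp
    define h where "h = (\<lambda>s. inverse (L1_norm M g) *\<^sub>R g s)"
    have h: "h \<in> L1_space M"
      unfolding h_def using g by (rule L1_space_scaleR)
    have "L1_norm M h = 1"
      using pos by (simp add: h_def L1_norm_def)
    moreover have "bdd_above ((\<lambda>g. \<bar>T g\<bar>) ` {g \<in> L1_space M. L1_norm M g \<le> 1})"
    proof (rule bdd_aboveI2)
      fix g :: "'a \<Rightarrow> 'x" assume "g \<in> {g \<in> L1_space M. L1_norm M g \<le> 1}"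
      then have "\<bar>T g\<bar> \<le> \<bar>C\<bar> * L1_norm M g" "L1_norm M g \<le> 1"
        using C[of g] mult_right_mono[OF abs_ge_self[of C] nonneg[of g]] by auto
      then show "\<bar>T g\<bar> \<le> \<bar>C\<bar>"
        using mult_left_le[of "L1_norm M g" "\<bar>C\<bar>"] by simp
    qed
    ultimately have "\<bar>T h\<bar> \<le> L1_dual_norm M T"
      unfolding L1_dual_norm_def using h by (intro cSUP_upper) auto
    moreover have "T h = inverse (L1_norm M g) * T g"
      using T g unfolding L1_dual_def h_def by blast
    ultimately show ?thesis
      using pos by (simp add: abs_mult field_simps)
  qed
qed

lemma L1_dual_add:
  "T \<in> L1_dual M \<Longrightarrow> g \<in> L1_space M \<Longrightarrow> h \<in> L1_space M \<Longrightarrow> T (\<lambda>s. g s + h s) = T g + T h"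
  unfolding L1_dual_def by blast

lemma L1_dual_scaleR: "T \<in> L1_dual M \<Longrightarrow> g \<in> L1_space M \<Longrightarrow> T (\<lambda>s. c *\<^sub>R g s) = c * T g"
  unfolding L1_dual_def by blast

lemma L1_dual_cong_AE:
  "T \<in> L1_dual M \<Longrightarrow> g \<in> L1_space M \<Longrightarrow> h \<in> L1_space M \<Longrightarrow> AE s in M. g s = h s \<Longrightarrow> T g = T h"
  unfolding L1_dual_def by blast

lemma L1_dual_diff:
  assumes "T \<in> L1_dual M" "g \<in> L1_space M" "h \<in> L1_space M"
  shows "T (\<lambda>s. g s - h s) = T g - T h"
  using L1_dual_add[OF assms(1,2) L1_space_scaleR[OF assms(3), of "-1"]]
    L1_dual_scaleR[OF assms(1,3), of "-1"] by simp

lemma L1_dual_sum: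
  assumes T: "T \<in> L1_dual M" and g: "\<And>i. i \<in> I \<Longrightarrow> g i \<in> L1_space M"
  shows "(\<lambda>s. \<Sum>i\<in>I. g i s) \<in> L1_space M" "T (\<lambda>s. \<Sum>i\<in>I. g i s) = (\<Sum>i\<in>I. T (g i))"
proof -
  have "(\<lambda>s. \<Sum>i\<in>I. g i s) \<in> L1_space M \<and> T (\<lambda>s. \<Sum>i\<in>I. g i s) = (\<Sum>i\<in>I. T (g i))"
    using g
  proof (induction I rule: infinite_finite_induct)
    case (insert i I)
    then show ?case by (simp add: L1_space_add L1_dual_add[OF T])
  qed (use L1_space_zero L1_dual_scaleR[OF T L1_space_zero, of 0] in auto)
  then show "(\<lambda>s. \<Sum>i\<in>I. g i s) \<in> L1_space M" "T (\<lambda>s. \<Sum>i\<in>I. g i s) = (\<Sum>i\<in>I. T (g i))"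
    by auto
qed

end

section \<open>Pointwise estimates from integral estimates\<close>

lemma blinfun_almost_norming_vector:
  fixes \<phi> :: "'x::real_normed_vector \<Rightarrow>\<^sub>L real"
  assumes "0 < e"
  obtains x where "norm x \<le> 1" "norm \<phi> - e \<le> blinfun_apply \<phi> x"
proof -
  have "\<exists>x. norm x \<le> 1 \<and> norm \<phi> - e \<le> blinfun_apply \<phi> x"
  proof (rule ccontr)
    assume "\<not> ?thesis"
    then have lt: "blinfun_apply \<phi> x \<le> norm \<phi> - e" if "norm x \<le> 1" for x
      using that by (meson linear)
    have "norm (blinfun_apply \<phi> y) \<le> (norm \<phi> - e) * norm y" for y
    proof (cases "y = 0")
      case False
      have "blinfun_apply \<phi> (inverse (norm y) *\<^sub>R y) \<le> norm \<phi> - e"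
        "blinfun_apply \<phi> (- inverse (norm y) *\<^sub>R y) \<le> norm \<phi> - e"
        by (rule lt; use False in simp)+
      then show ?thesis
        using False by (simp add: blinfun.scaleR_right blinfun.minus_right field_simps abs_le_iff)
    qed simp
    moreover have "0 \<le> norm \<phi> - e"
      using lt[of 0] by simp
    ultimately have "norm \<phi> \<le> norm \<phi> - e"
      by (intro norm_blinfun_bound)
    then show False using assms by simp
  qed
  then show ?thesis using that by blast
qed

text \<open>
  The exceptional null set in the hypothesis depends on \<open>x\<close>, and the unit ball need not be separable.
  The simple functions approximating \<open>h\<close> have only countably many values, however, and almost norming
  vectors for these values suffice to compute \<open>norm (h s)\<close> in the limit.
\<close>

lemma AE_norm_le_if_AE_apply_le:
  fixes h :: "'a \<Rightarrow> ('x::real_normed_vector \<Rightarrow>\<^sub>L real)"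
  assumes h: "strongly_measurable M h"
    and le: "\<And>x. norm x \<le> 1 \<Longrightarrow> AE s in M. blinfun_apply (h s) x \<le> b s"
  shows "AE s in M. norm (h s) \<le> b s"
proof -
  obtain u where u: "\<And>n. simple_function M (u n)" and lim: "AE s in M. (\<lambda>n. u n s) \<longlonglongrightarrow> h s"
    using h unfolding strongly_measurable_def by auto
  have "\<forall>\<phi> :: 'x \<Rightarrow>\<^sub>L real. \<forall>n. \<exists>x. norm x \<le> 1 \<and> norm \<phi> - 1 / real (Suc n) \<le> blinfun_apply \<phi> x"
    by (metis blinfun_almost_norming_vector zero_less_divide_1_iff of_nat_0_less_iff zero_less_Suc)
  then obtain x where "\<forall>\<phi> :: 'x \<Rightarrow>\<^sub>L real. \<forall>n. norm (x \<phi> n) \<le> 1 \<and>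
      norm \<phi> - 1 / real (Suc n) \<le> blinfun_apply \<phi> (x \<phi> n)"
    unfolding choice_iff by blast
  then have x: "\<And>\<phi> n. norm (x \<phi> n) \<le> 1"
    "\<And>\<phi> n. norm \<phi> - 1 / real (Suc n) \<le> blinfun_apply \<phi> (x \<phi> n)"
    by auto
  have "AE s in M. \<forall>n. \<forall>\<phi>\<in>u n ` space M. blinfun_apply (h s) (x \<phi> n) \<le> b s"
    unfolding AE_all_countable
    using simple_functionD(1)[OF u] by (intro allI AE_finite_allI le x(1))
  then show ?thesis
    using lim AE_space
  proof eventually_elim
    case (elim s)
    \<comment> \<open>The vector almost norming the \<open>n\<close>-th approximation \<open>u n s\<close> is almost norming for \<open>h s\<close>.\<close>
    have "norm (u n s) - 1 / real (Suc n) - norm (h s - u n s) \<le> b s" for n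
    proof -
      let ?x = "x (u n s) n"
      have "\<bar>blinfun_apply (h s - u n s) ?x\<bar> \<le> norm (h s - u n s) * norm ?x"
        using norm_blinfun[of "h s - u n s" ?x] by simp
      also have "\<dots> \<le> norm (h s - u n s)"
        by (simp add: mult_left_le x(1))
      finally have "blinfun_apply (u n s) ?x - norm (h s - u n s) \<le> blinfun_apply (h s) ?x"
        by (simp add: blinfun.diff_left)
      moreover have "blinfun_apply (h s) ?x \<le> b s"
        using elim by blast
      ultimately show ?thesis
        using x(2)[of "u n s" n] by simp
    qed
    moreover have "(\<lambda>n. norm (u n s) - 1 / real (Suc n) - norm (h s - u n s)) \<longlonglongrightarrow>
        norm (h s) - 0 - norm (h s - h s)"
      using elim(2) LIMSEQ_inverse_real_of_nat
      by (intro tendsto_intros) (auto simp: inverse_eq_divide)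
    ultimately show ?case
      by (intro LIMSEQ_le_const2[where X = "\<lambda>n. norm (u n s) - 1 / real (Suc n) - norm (h s - u n s)"])
         auto
  qed
qed

text \<open>Integrate the difference over the set where the inequality fails.\<close>

lemma AE_le_if_set_integrals_le:
  fixes p q :: "'a \<Rightarrow> real"
  assumes p: "integrable M p" and q: "integrable M q"
    and le: "\<And>E. E \<in> sets M \<Longrightarrow> (\<integral>s. indicator E s * p s \<partial>M) \<le> (\<integral>s. indicator E s * q s \<partial>M)"
  shows "AE s in M. p s \<le> q s"
proof -
  have [measurable]: "p \<in> borel_measurable M" "q \<in> borel_measurable M"
    using p q by auto
  define E where "E = {s \<in> space M. q s < p s}"
  have E[measurable]: "E \<in> sets M"
    unfolding E_def by measurable
  have int: "integrable M (\<lambda>s. indicator E s * p s)" "integrable M (\<lambda>s. indicator E s * q s)"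
    using integrable_mult_indicator[OF E p] integrable_mult_indicator[OF E q] by auto
  define d where "d s = indicator E s * p s - indicator E s * q s" for s
  have d: "integrable M d"
    unfolding d_def using int by auto
  have d_nonneg: "0 \<le> d s" for s
    by (auto simp: d_def E_def indicator_def)
  have "integral\<^sup>L M d \<le> 0"
    unfolding d_def using int le[OF E] by simp
  then have "integral\<^sup>L M d = 0"
    using Bochner_Integration.integral_nonneg[of M d] d_nonneg by (simp add: antisym)
  then have "AE s in M. d s = 0"
    using integral_nonneg_eq_0_iff_AE[OF d] d_nonneg by simp
  then show ?thesis
    using AE_space by eventually_elim (auto simp: d_def E_def indicator_def split: if_splits)
qed

section \<open>The vector measure induced by a functional\<close>

text \<open>
  Evaluation at \<open>x\<close> maps the simple functions witnessing the strong integral of \<open>h\<close> to simple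
  functions witnessing the scalar integral. This is the passage from the density of a dual-valued
  measure to ordinary integrals.
\<close>

lemma (in complete_measure) has_strong_bochner_integral_apply:
  fixes h :: "'a \<Rightarrow> ('x::real_normed_vector \<Rightarrow>\<^sub>L real)"
  assumes "has_strong_bochner_integral M h \<phi>"
  shows "has_bochner_integral M (\<lambda>s. blinfun_apply (h s) x) (blinfun_apply \<phi> x)"
proof -
  obtain u where h: "strongly_measurable M h"
    and u: "\<And>n. Bochner_Integration.simple_bochner_integrable M (u n)"
    and lim: "(\<lambda>n. \<integral>\<^sup>+s. ennreal (norm (h s - u n s)) \<partial>M) \<longlonglongrightarrow> 0"
    and \<phi>: "(\<lambda>n. Bochner_Integration.simple_bochner_integral M (u n)) \<longlonglongrightarrow> \<phi>"
    using assms unfolding has_strong_bochner_integral_def by blast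
  have lin: "linear (\<lambda>\<psi>. blinfun_apply \<psi> x)"
    by (intro linearI) (auto simp: blinfun.add_left blinfun.scaleR_left)
  show ?thesis
  proof
    show "(\<lambda>s. blinfun_apply (h s) x) \<in> borel_measurable M"
      by (intro borel_strongly_measurable strongly_measurable_blinfun_apply h
          strongly_measurable_simple) auto
    show "Bochner_Integration.simple_bochner_integrable M (\<lambda>s. blinfun_apply (u n s) x)" for n
      using simple_bochner_integrable_compose2[of "\<lambda>\<psi> _. blinfun_apply \<psi> x", OF _ u u] by simp
    show "(\<lambda>n. Bochner_Integration.simple_bochner_integral M (\<lambda>s. blinfun_apply (u n s) x)) \<longlonglongrightarrow> blinfun_apply \<phi> x"
      unfolding simple_bochner_integral_linear[OF lin u] by (intro blinfun.tendsto \<phi> tendsto_const)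
    have "norm (blinfun_apply (h s) x - blinfun_apply (u n s) x) \<le> norm x * norm (h s - u n s)" for s n
      using norm_blinfun[of "h s - u n s" x] by (simp add: blinfun.diff_left mult.commute)
    then have "(\<integral>\<^sup>+s. norm (blinfun_apply (h s) x - blinfun_apply (u n s) x) \<partial>M) \<le>
        (\<integral>\<^sup>+s. ennreal (norm x) * ennreal (norm (h s - u n s)) \<partial>M)" for n
      by (intro nn_integral_mono) (auto simp flip: ennreal_mult intro!: ennreal_leI)
    also have "\<dots> n = ennreal (norm x) * (\<integral>\<^sup>+s. ennreal (norm (h s - u n s)) \<partial>M)" for n
    proof (rule nn_integral_cmult)
      have "strongly_measurable M (u n)"
        using u by (intro strongly_measurable_simple)
        (auto elim: Bochner_Integration.simple_bochner_integrable.cases)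
      then show "(\<lambda>s. ennreal (norm (h s - u n s))) \<in> borel_measurable M"
        by (intro measurable_compose[OF borel_norm_strongly_measurable[OF
                strongly_measurable_diff[OF h]] measurable_ennreal])
    qed
    finally have le: "(\<integral>\<^sup>+s. norm (blinfun_apply (h s) x - blinfun_apply (u n s) x) \<partial>M) \<le>
        ennreal (norm x) * (\<integral>\<^sup>+s. ennreal (norm (h s - u n s)) \<partial>M)" for n .
    have upper: "(\<lambda>n. ennreal (norm x) * (\<integral>\<^sup>+s. ennreal (norm (h s - u n s)) \<partial>M)) \<longlonglongrightarrow> 0"
      using ennreal_tendsto_cmult[OF _ lim, of "ennreal (norm x)"] by simp
    have lower: "\<forall>\<^sub>F n in sequentially.
        0 \<le> (\<integral>\<^sup>+s. norm (blinfun_apply (h s) x - blinfun_apply (u n s) x) \<partial>M)"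
      by simp
    show "(\<lambda>n. \<integral>\<^sup>+s. norm (blinfun_apply (h s) x - blinfun_apply (u n s) x) \<partial>M) \<longlonglongrightarrow> 0"
      by (rule tendsto_sandwich[OF lower always_eventually[OF allI[OF le]] tendsto_const upper])
  qed
qed

text \<open>
  For \<open>T g = \<integral> G s (g s) d\<mu>\<close> this set function is the vector measure with density \<open>w G\<close>.
\<close>

definition weighted_trace ::
    "('a \<Rightarrow> real) \<Rightarrow> (('a \<Rightarrow> 'x::real_normed_vector) \<Rightarrow> real) \<Rightarrow> 'a set \<Rightarrow> ('x \<Rightarrow>\<^sub>L real)" where
  "weighted_trace w T E = Blinfun (\<lambda>x. T (\<lambda>s. w s *\<^sub>R (indicator E s *\<^sub>R x)))"

context complete_measure
begin

context
  fixes w :: "'a \<Rightarrow> real" and T :: "('a \<Rightarrow> 'x::real_normed_vector) \<Rightarrow> real" and C :: real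
  assumes w: "integrable M w" "\<And>s. 0 < w s"
    and T: "T \<in> L1_dual M"
    and C: "0 \<le> C" "\<And>g. g \<in> L1_space M \<Longrightarrow> \<bar>T g\<bar> \<le> C * L1_norm M g"
begin

lemma L1_space_weighted_indicator:
  assumes "E \<in> sets M"
  shows "(\<lambda>s. w s *\<^sub>R (indicator E s *\<^sub>R x)) \<in> L1_space M"
  by (intro L1_space_weighted_simple w simple_function_compose2[where h = "(*\<^sub>R)"]) (use assms in auto)

lemma integrable_weight_indicator: "E \<in> sets M \<Longrightarrow> integrable M (\<lambda>s. indicator E s * w s)"
  using integrable_mult_indicator[OF _ w(1)] by simp

lemma weighted_trace_bound:
  assumes "E \<in> sets M"
  shows "\<bar>T (\<lambda>s. w s *\<^sub>R (indicator E s *\<^sub>R x))\<bar> \<le> C * (\<integral>s. indicator E s * w s \<partial>M) * norm x"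
proof -
  have "L1_norm M (\<lambda>s. w s *\<^sub>R (indicator E s *\<^sub>R x)) = (\<integral>s. indicator E s * w s * norm x \<partial>M)"
    unfolding L1_norm_def
    by (intro Bochner_Integration.integral_cong) (auto simp: indicator_def less_imp_le[OF w(2)])
  then show ?thesis
    using C(2)[OF L1_space_weighted_indicator[OF assms, of x]] by simp
qed

lemma weighted_trace_apply:
  assumes E: "E \<in> sets M"
  shows "blinfun_apply (weighted_trace w T E) x = T (\<lambda>s. w s *\<^sub>R (indicator E s *\<^sub>R x))"
proof -
  note L1 = L1_space_weighted_indicator[OF E]
  have "bounded_linear (\<lambda>x. T (\<lambda>s. w s *\<^sub>R (indicator E s *\<^sub>R x)))"
  proof (rule bounded_linear_intro)
    show "T (\<lambda>s. w s *\<^sub>R (indicator E s *\<^sub>R (x + y))) =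
      T (\<lambda>s. w s *\<^sub>R (indicator E s *\<^sub>R x)) + T (\<lambda>s. w s *\<^sub>R (indicator E s *\<^sub>R y))" for x y
      by (subst L1_dual_add[OF T L1 L1, symmetric]) (simp add: scaleR_add_right)
    show "T (\<lambda>s. w s *\<^sub>R (indicator E s *\<^sub>R (r *\<^sub>R x))) =
      r *\<^sub>R T (\<lambda>s. w s *\<^sub>R (indicator E s *\<^sub>R x))" for r x
      unfolding real_scaleR_def
      by (subst L1_dual_scaleR[OF T L1, symmetric]) (simp add: mult_ac)
    show "norm (T (\<lambda>s. w s *\<^sub>R (indicator E s *\<^sub>R x))) \<le> norm x * (C * (\<integral>s. indicator E s * w s \<partial>M))" for x
      using weighted_trace_bound[OF E, of x] by (simp add: mult_ac)
  qed
  then show ?thesis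
    unfolding weighted_trace_def by (simp add: bounded_linear_Blinfun_apply)
qed

text \<open>
  Together with finite additivity, this domination by a finite measure is the source of countable
  additivity, bounded variation and absolute continuity.
\<close>

lemma norm_weighted_trace_le:
  assumes "E \<in> sets M"
  shows "norm (weighted_trace w T E) \<le> C * (\<integral>s. indicator E s * w s \<partial>M)"
proof (rule norm_blinfun_bound)
  show "0 \<le> C * (\<integral>s. indicator E s * w s \<partial>M)"
    using C(1) less_imp_le[OF w(2)]
    by (intro mult_nonneg_nonneg Bochner_Integration.integral_nonneg) auto
  show "norm (blinfun_apply (weighted_trace w T E) x) \<le> C * (\<integral>s. indicator E s * w s \<partial>M) * norm x" for x
    using weighted_trace_bound[OF assms, of x] by (simp add: weighted_trace_apply[OF assms])
qed

lemma weighted_trace_Un: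
  assumes "E \<in> sets M" "F \<in> sets M" "E \<inter> F = {}"
  shows "weighted_trace w T (E \<union> F) = weighted_trace w T E + weighted_trace w T F"
proof (rule blinfun_eqI)
  fix x :: 'x
  have "(\<lambda>s. w s *\<^sub>R (indicator (E \<union> F) s *\<^sub>R x)) =
      (\<lambda>s. w s *\<^sub>R (indicator E s *\<^sub>R x) + w s *\<^sub>R (indicator F s *\<^sub>R x))"
    using assms(3) by (auto simp: fun_eq_iff indicator_def)
  then show "blinfun_apply (weighted_trace w T (E \<union> F)) x =
      blinfun_apply (weighted_trace w T E + weighted_trace w T F) x"
    using assms L1_dual_add[OF T L1_space_weighted_indicator[OF assms(1), of x]
        L1_space_weighted_indicator[OF assms(2), of x]]
    by (simp add: weighted_trace_apply blinfun.add_left)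
qed

lemma measure_density_weight:
  assumes [measurable]: "E \<in> sets M"
  shows "measure (density M (\<lambda>s. ennreal (w s))) E = (\<integral>s. indicator E s * w s \<partial>M)"
proof -
  have [measurable]: "w \<in> borel_measurable M"
    using w(1) by auto
  have "emeasure (density M (\<lambda>s. ennreal (w s))) E = (\<integral>\<^sup>+s. ennreal (indicator E s * w s) \<partial>M)"
    by (subst emeasure_density) (auto intro!: nn_integral_cong simp: indicator_def)
  also have "\<dots> = ennreal (\<integral>s. indicator E s * w s \<partial>M)"
    using less_imp_le[OF w(2)]
    by (intro nn_integral_eq_integral integrable_weight_indicator) (auto simp: indicator_def)
  finally show ?thesis
    using less_imp_le[OF w(2)]
    by (simp add: measure_def indicator_def)
qed

lemma finite_measure_density_weight: "finite_measure (density M (\<lambda>s. ennreal (w s)))"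
proof
  have [measurable]: "w \<in> borel_measurable M"
    using w(1) by auto
  have "emeasure (density M (\<lambda>s. ennreal (w s))) (space M) = (\<integral>\<^sup>+s. ennreal (w s) \<partial>M)"
    by (subst emeasure_density) (auto intro!: nn_integral_cong simp: indicator_def)
  also have "\<dots> = ennreal (\<integral>s. w s \<partial>M)"
    using less_imp_le[OF w(2)] w(1) by (intro nn_integral_eq_integral) auto
  finally show "emeasure (density M (\<lambda>s. ennreal (w s))) (space (density M (\<lambda>s. ennreal (w s)))) \<noteq> \<infinity>"
    by simp
qed

text \<open>
  A finitely additive set function dominated by a finite measure \<open>m\<close> is countably additive in norm:
  the error after \<open>n\<close> terms is its value on the remaining union, whose \<open>m\<close>-measure tends to \<open>0\<close>.
\<close>

lemma vector_measure_weighted_trace: "vector_measure M (weighted_trace w T)"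
  unfolding vector_measure_def
proof (intro allI impI)
  fix A :: "nat \<Rightarrow> 'a set"
  assume A: "range A \<subseteq> sets M" and disj: "disjoint_family A"
  let ?m = "measure (density M (\<lambda>s. ennreal (w s)))"
  let ?\<nu> = "weighted_trace w T"
  let ?B = "\<lambda>n. \<Union>i<n. A i" and ?R = "\<lambda>n. \<Union>i\<in>{n..}. A i"
  have An: "A n \<in> sets M" for n
    using A by auto
  then have sets: "?B n \<in> sets M" "?R n \<in> sets M" for n
    by auto
  interpret m: finite_measure "density M (\<lambda>s. ennreal (w s))"
    by (rule finite_measure_density_weight)
  have split: "(\<Union>i. A i) = ?B n \<union> ?R n" for n
  proof -
    have "UNIV = {..<n} \<union> {n..}" by auto
    then show ?thesis by (metis UN_Un)
  qed
  have same: "i = j" if "x \<in> A i" "x \<in> A j" for i j x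
    using disj that unfolding disjoint_family_on_def by blast
  have inter: "?B n \<inter> ?R n = {}" for n
    unfolding disjoint_iff using same by (metis UN_E lessThan_iff atLeast_iff not_less)
  have fin_\<nu>: "?\<nu> (?B n) = (\<Sum>i<n. ?\<nu> (A i))" for n
  proof (induction n)
    case 0
    have "norm (?\<nu> {}) \<le> 0"
      using norm_weighted_trace_le[of "{}"] by simp
    then show ?case by simp
  next
    case (Suc n)
    have "?\<nu> (?B n \<union> A n) = ?\<nu> (?B n) + ?\<nu> (A n)"
    proof (intro weighted_trace_Un sets An)
      show "?B n \<inter> A n = {}"
        unfolding disjoint_iff using same by (metis UN_E lessThan_iff less_irrefl)
    qed
    then show ?case
      using Suc by (simp add: lessThan_Suc Un_commute)
  qed
  have fin_m: "?m (?B n) = (\<Sum>i<n. ?m (A i))" for n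
    using An disj by (intro m.finite_measure_finite_Union) (auto simp: disjoint_family_on_def)
  have "(\<lambda>n. \<Sum>i<n. ?m (A i)) \<longlonglongrightarrow> ?m (\<Union>i. A i)"
    using m.finite_measure_UNION[of A] A disj by (simp add: sums_def)
  then have "(\<lambda>n. C * (?m (\<Union>i. A i) - ?m (?B n))) \<longlonglongrightarrow> C * (?m (\<Union>i. A i) - ?m (\<Union>i. A i))"
    unfolding fin_m by (intro tendsto_intros)
  moreover have "?m (\<Union>i. A i) - ?m (?B n) = ?m (?R n)" for n
    using m.finite_measure_Union[of "?B n" "?R n"] sets inter[of n] by (simp add: split[of n])
  ultimately have lim: "(\<lambda>n. C * ?m (?R n)) \<longlonglongrightarrow> 0"
    by simp
  have le: "norm (?\<nu> (?B n) - ?\<nu> (\<Union>i. A i)) \<le> C * ?m (?R n)" for n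
    using norm_weighted_trace_le[OF sets(2), of n] weighted_trace_Un[OF sets inter, of n]
    by (simp add: split[of n] measure_density_weight[OF sets(2)])
  have "(\<lambda>n. ?\<nu> (?B n) - ?\<nu> (\<Union>i. A i)) \<longlonglongrightarrow> 0"
    by (rule Lim_null_comparison[OF always_eventually[OF allI[OF le]] lim])
  then show "(\<lambda>i. ?\<nu> (A i)) sums ?\<nu> (\<Union>i. A i)"
    unfolding sums_def fin_\<nu> by (rule LIM_zero_cancel)
qed

lemma finite_variation_weighted_trace: "finite_variation M (weighted_trace w T)"
  unfolding finite_variation_def
proof (intro exI allI impI)
  fix P assume P: "finite P" "P \<subseteq> sets M" "partition_on (space M) P"
  let ?m = "measure (density M (\<lambda>s. ennreal (w s)))"
  interpret m: finite_measure "density M (\<lambda>s. ennreal (w s))"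
    by (rule finite_measure_density_weight)
  have "(\<Sum>E\<in>P. norm (weighted_trace w T E)) \<le> (\<Sum>E\<in>P. C * ?m E)"
    using P(2) norm_weighted_trace_le by (intro sum_mono) (auto simp: measure_density_weight)
  also have "\<dots> = C * ?m (\<Union>E\<in>P. E)"
    using P by (subst m.finite_measure_finite_Union)
      (auto simp: sum_distrib_left partition_on_def disjoint_family_on_def disjoint_def)
  finally show "(\<Sum>E\<in>P. norm (weighted_trace w T E)) \<le> C * ?m (space M)"
    using P(3) by (simp add: partition_on_def)
qed

lemma abs_continuous_weighted_trace: "abs_continuous M (weighted_trace w T)"
  unfolding abs_continuous_def
proof (intro ballI impI)
  fix E assume E: "E \<in> sets M" "emeasure M E = 0"
  then have "AE s in M. s \<notin> E"
    by (intro AE_not_in) (simp add: null_setsI)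
  then have "(\<integral>s. indicator E s * w s \<partial>M) = (\<integral>s. 0 \<partial>M)"
    by (intro integral_cong_AE) (use E w(1) in \<open>auto elim!: eventually_mono\<close>)
  then show "weighted_trace w T E = 0"
    using norm_weighted_trace_le[OF E(1)] by simp
qed

end

section \<open>Integral representation of functionals\<close>

lemma integrable_blinfun_apply_bounded:
  fixes G :: "'a \<Rightarrow> ('x::real_normed_vector \<Rightarrow>\<^sub>L real)"
  assumes G: "strongly_measurable M G" "AE s in M. norm (G s) \<le> C" and g: "g \<in> L1_space M"
  shows "integrable M (\<lambda>s. blinfun_apply (G s) (g s))"
    and "\<bar>\<integral>s. blinfun_apply (G s) (g s) \<partial>M\<bar> \<le> C * L1_norm M g"
proof -
  have le: "AE s in M. \<bar>blinfun_apply (G s) (g s)\<bar> \<le> C * norm (g s)"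
    using G(2)
  proof eventually_elim
    case (elim s)
    then show ?case
      using norm_blinfun[of "G s" "g s"] mult_right_mono[OF elim, of "norm (g s)"] by simp
  qed
  have int: "integrable M (\<lambda>s. C * norm (g s))"
    using g by (simp add: L1_space_def)
  show *: "integrable M (\<lambda>s. blinfun_apply (G s) (g s))"
  proof (rule Bochner_Integration.integrable_bound[OF int])
    show "(\<lambda>s. blinfun_apply (G s) (g s)) \<in> borel_measurable M"
      by (intro borel_strongly_measurable strongly_measurable_blinfun_apply G
          L1_space_strongly_measurable[OF g])
    show "AE s in M. norm (blinfun_apply (G s) (g s)) \<le> norm (C * norm (g s))"
      using le by eventually_elim auto
  qed
  have "\<bar>\<integral>s. blinfun_apply (G s) (g s) \<partial>M\<bar> \<le> (\<integral>s. \<bar>blinfun_apply (G s) (g s)\<bar> \<partial>M)"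
    by (rule integral_abs_bound)
  also have "\<dots> \<le> (\<integral>s. C * norm (g s) \<partial>M)"
    using * by (intro integral_mono_AE int le) auto
  finally show "\<bar>\<integral>s. blinfun_apply (G s) (g s) \<partial>M\<bar> \<le> C * L1_norm M g"
    by (simp add: L1_norm_def)
qed

text \<open>
  The duality \<open>L\<^sup>1(\<mu>, X)\<^sup>* = L\<^sup>\<infinity>(\<mu>, X\<^sup>*)\<close>. The function \<open>G\<close> is the density of the weighted vector
  measure divided by the weight. The bound \<open>C\<close> passes from \<open>T\<close> to \<open>G\<close> unchanged, which the application
  to support functionals relies on.
\<close>

theorem L1_dual_representation:
  fixes T :: "('a \<Rightarrow> 'x::real_normed_vector) \<Rightarrow> real"
  assumes sf: "sigma_finite_measure M"
    and RNP: "wide_RNP M TYPE('x \<Rightarrow>\<^sub>L real)"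
    and T: "T \<in> L1_dual M"
    and C: "0 \<le> C" "\<And>g. g \<in> L1_space M \<Longrightarrow> \<bar>T g\<bar> \<le> C * L1_norm M g"
  obtains G where "strongly_measurable M G" "AE s in M. norm (G s) \<le> C"
    and "\<And>g. g \<in> L1_space M \<Longrightarrow> T g = (\<integral>s. blinfun_apply (G s) (g s) \<partial>M)"
proof -
  obtain w :: "'a \<Rightarrow> real" where wm: "w \<in> borel_measurable M" and w: "integrable M w" "\<And>s. 0 < w s"
    by (rule sigma_finite_measure.obtain_positive_integrable_function[OF sf]) blast
  note ctx = w T C
  obtain h where h: "h \<in> L1_space M"
    and h_int: "\<And>E. E \<in> sets M \<Longrightarrow>
      has_strong_bochner_integral M (\<lambda>s. indicator E s *\<^sub>R h s) (weighted_trace w T E)"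
    using RNP vector_measure_weighted_trace[OF ctx] finite_variation_weighted_trace[OF ctx]
      abs_continuous_weighted_trace[OF ctx]
    unfolding wide_RNP_def by meson
  have h_apply: "has_bochner_integral M (\<lambda>s. indicator E s * blinfun_apply (h s) x)
      (T (\<lambda>s. w s *\<^sub>R (indicator E s *\<^sub>R x)))" if "E \<in> sets M" for E x
    using has_strong_bochner_integral_apply[OF h_int[OF that], of x]
    by (simp add: weighted_trace_apply[OF ctx that] blinfun.scaleR_left)
  have hx: "integrable M (\<lambda>s. blinfun_apply (h s) x)" for x
  proof -
    have "integrable M (\<lambda>s. indicator (space M) s * blinfun_apply (h s) x)"
      using h_apply[OF sets.top] by (rule integrable.intros)
    then show ?thesis
      by (simp cong: Bochner_Integration.integrable_cong)
  qed
  \<comment> \<open>Evaluated at \<open>x\<close>, both sides are densities, and the domination of the vector measure compares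
    their integrals over every measurable set.\<close>
  have h_le: "AE s in M. norm (h s) \<le> C * w s"
  proof (rule AE_norm_le_if_AE_apply_le[OF L1_space_strongly_measurable[OF h]])
    fix x :: 'x assume x: "norm x \<le> 1"
    show "AE s in M. blinfun_apply (h s) x \<le> C * w s"
    proof (rule AE_le_if_set_integrals_le[OF hx])
      fix E assume E: "E \<in> sets M"
      have "(\<integral>s. indicator E s * blinfun_apply (h s) x \<partial>M) = T (\<lambda>s. w s *\<^sub>R (indicator E s *\<^sub>R x))"
        using h_apply[OF E] by (rule has_bochner_integral_integral_eq)
      also have "\<dots> \<le> C * (\<integral>s. indicator E s * w s \<partial>M) * norm x"
        using weighted_trace_bound[OF ctx E, of x] by simp
      also have "\<dots> \<le> C * (\<integral>s. indicator E s * w s \<partial>M)"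
        using order.trans[OF norm_ge_zero norm_weighted_trace_le[OF ctx E]] x
        by (intro mult_left_le) auto
      also have "\<dots> = (\<integral>s. indicator E s * (C * w s) \<partial>M)"
        by (simp add: mult.left_commute)
      finally show "(\<integral>s. indicator E s * blinfun_apply (h s) x \<partial>M) \<le> (\<integral>s. indicator E s * (C * w s) \<partial>M)" .
    qed (use w in auto)
  qed
  define G where "G s = inverse (w s) *\<^sub>R h s" for s
  have G: "strongly_measurable M G"
    unfolding G_def using wm
    by (intro strongly_measurable_scaleR strongly_measurable_borel L1_space_strongly_measurable[OF h]) auto
  have G_le: "AE s in M. norm (G s) \<le> C"
    using h_le
  proof eventually_elim
    case (elim s)
    then show ?case
      using w(2)[of s] by (simp add: G_def field_simps)
  qed
  note G_int = integrable_blinfun_apply_bounded[OF G G_le]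
  \<comment> \<open>By linearity the formula reduces to the functions \<open>w 1\<^sub>E y\<close>, with \<open>E\<close> a level set of \<open>v\<close>; for
    these it is the density property of \<open>h\<close>, as the weights cancel.\<close>
  have T_simple: "T (\<lambda>s. w s *\<^sub>R v s) = (\<integral>s. blinfun_apply (G s) (w s *\<^sub>R v s) \<partial>M)"
    if v: "simple_function M v" for v
  proof -
    let ?E = "\<lambda>y. v -` {y} \<inter> space M"
    let ?g = "\<lambda>y s. w s *\<^sub>R (indicator (?E y) s *\<^sub>R y)"
    note E = simple_functionD(2)[OF v]
    have L1: "?g y \<in> L1_space M" for y
      by (rule L1_space_weighted_indicator[OF ctx E])
    have v_eq: "w s *\<^sub>R v s = (\<Sum>y\<in>v ` space M. ?g y s)" if "s \<in> space M" for s
    proof -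
      have "(\<Sum>y\<in>v ` space M. ?g y s) = (\<Sum>y\<in>v ` space M. if v s = y then w s *\<^sub>R y else 0)"
        using that by (intro sum.cong) auto
      then show ?thesis
        using that simple_functionD(1)[OF v] by simp
    qed
    have "T (\<lambda>s. w s *\<^sub>R v s) = T (\<lambda>s. \<Sum>y\<in>v ` space M. ?g y s)"
      by (intro L1_dual_cong_AE[OF T] L1_space_weighted_simple w v L1_dual_sum[OF T] L1)
         (auto simp: v_eq)
    also have "\<dots> = (\<Sum>y\<in>v ` space M. T (?g y))"
      by (intro L1_dual_sum[OF T] L1)
    also have "\<dots> = (\<Sum>y\<in>v ` space M. \<integral>s. blinfun_apply (G s) (?g y s) \<partial>M)"
    proof (intro sum.cong refl)
      fix y
      have "blinfun_apply (G s) (?g y s) = indicator (?E y) s * blinfun_apply (h s) y" for s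
        using w(2)[of s] by (simp add: G_def blinfun.scaleR_left blinfun.scaleR_right)
      then show "T (?g y) = (\<integral>s. blinfun_apply (G s) (?g y s) \<partial>M)"
        using has_bochner_integral_integral_eq[OF h_apply[OF E, of "{y}" y]] by simp
    qed
    also have "\<dots> = (\<integral>s. (\<Sum>y\<in>v ` space M. blinfun_apply (G s) (?g y s)) \<partial>M)"
      using G_int(1)[OF L1] by (intro Bochner_Integration.integral_sum[symmetric]) auto
    also have "\<dots> = (\<integral>s. blinfun_apply (G s) (w s *\<^sub>R v s) \<partial>M)"
      by (intro Bochner_Integration.integral_cong) (auto simp: v_eq blinfun.sum_right)
    finally show ?thesis .
  qed
  have "T g = (\<integral>s. blinfun_apply (G s) (g s) \<partial>M)" if g: "g \<in> L1_space M" for g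
  proof -
    obtain v where v: "\<And>n. simple_function M (v n)"
      and lim: "(\<lambda>n. L1_norm M (\<lambda>s. w s *\<^sub>R v n s - g s)) \<longlonglongrightarrow> 0"
      using weighted_simple_dense_L1[OF w g] by blast
    define e where "e = (\<integral>s. blinfun_apply (G s) (g s) \<partial>M) - T g"
    \<comment> \<open>Both functionals have norm at most \<open>C\<close> and agree on \<open>w v\<close>, hence the factor \<open>2\<close>.\<close>
    have "\<bar>e\<bar> \<le> 2 * (C * L1_norm M (\<lambda>s. w s *\<^sub>R v n s - g s))" for n
    proof -
      note V = L1_space_weighted_simple[OF w(1) v, of n]
      note d = L1_space_diff[OF V g]
      have "(\<integral>s. blinfun_apply (G s) (w s *\<^sub>R v n s - g s) \<partial>M) =
          T (\<lambda>s. w s *\<^sub>R v n s) - (\<integral>s. blinfun_apply (G s) (g s) \<partial>M)"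
        unfolding T_simple[OF v] blinfun.diff_right
        by (intro Bochner_Integration.integral_diff G_int V g)
      then show ?thesis
        using G_int(2)[OF d] C(2)[OF d] L1_dual_diff[OF T V g] by (simp add: e_def)
    qed
    moreover have "(\<lambda>n. 2 * (C * L1_norm M (\<lambda>s. w s *\<^sub>R v n s - g s))) \<longlonglongrightarrow> 2 * (C * 0)"
      by (intro tendsto_intros lim)
    ultimately have "\<bar>e\<bar> \<le> 0"
      by (intro LIMSEQ_le_const[where X = "\<lambda>n. 2 * (C * L1_norm M (\<lambda>s. w s *\<^sub>R v n s - g s))"]) auto
    then show ?thesis by (simp add: e_def)
  qed
  then show ?thesis
    using G G_le by (intro that)
qed

text \<open>
  The pointwise inequality \<open>G s (f s) \<le> \<parallel>f s\<parallel>\<close> becomes an equality after integration, so it is an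
  equality almost everywhere.
\<close>

lemma support_functionals_AE:
  fixes G :: "'a \<Rightarrow> ('x::real_normed_vector \<Rightarrow>\<^sub>L real)"
  assumes G: "strongly_measurable M G" "AE s in M. norm (G s) \<le> 1" and f: "f \<in> L1_space M"
    and eq: "(\<integral>s. blinfun_apply (G s) (f s) \<partial>M) = L1_norm M f"
  shows "AE s in M. s \<in> space M - zero_set M f \<longrightarrow> G s \<in> support_functionals (f s)"
proof -
  note int = integrable_blinfun_apply_bounded(1)[OF G f] L1_space_integrable_norm[OF f]
  have le: "blinfun_apply (G s) (f s) \<le> norm (G s) * norm (f s)" for s
    using norm_blinfun[of "G s" "f s"] by simp
  have "AE s in M. 0 \<le> norm (f s) - blinfun_apply (G s) (f s)"
    using G(2)
  proof eventually_elim
    case (elim s)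
    then show ?case
      using le[of s] mult_right_mono[OF elim, of "norm (f s)"] by simp
  qed
  moreover have "(\<integral>s. norm (f s) - blinfun_apply (G s) (f s) \<partial>M) = 0"
    using int eq by (simp add: L1_norm_def)
  ultimately have "AE s in M. norm (f s) - blinfun_apply (G s) (f s) = 0"
    using integral_nonneg_eq_0_iff_AE[OF Bochner_Integration.integrable_diff[OF int(2,1)]] by simp
  then show ?thesis
    using G(2)
  proof eventually_elim
    case (elim s)
    show ?case
    proof
      assume "s \<in> space M - zero_set M f"
      then have "0 < norm (f s)"
        by (simp add: zero_set_def)
      moreover have "norm (f s) \<le> norm (G s) * norm (f s)"
        using le[of s] elim(1) by simp
      ultimately have "1 \<le> norm (G s)"
        by simp
      then show "G s \<in> support_functionals (f s)"
        using elim by (simp add: support_functionals_def)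
    qed
  qed
qed

end

theorem lemma3p3:
  fixes M :: "'a measure"
    and f :: "'a \<Rightarrow> 'x::banach"
    and T :: "('a \<Rightarrow> 'x) \<Rightarrow> real"
  assumes "sigma_finite_measure M"
    and "complete_measure M"
    and "wide_RNP M TYPE('x \<Rightarrow>\<^sub>L real)"
    and "f \<in> L1_space M"
    and "\<not> (AE s in M. f s = 0)"
    and "T \<in> L1_support_functionals M f"
  shows "\<exists>G :: 'a \<Rightarrow> ('x \<Rightarrow>\<^sub>L real). G \<in> Linf_space M \<and>
           (AE s in M. s \<in> space M - zero_set M f \<longrightarrow> G s \<in> support_functionals (f s)) \<and>
           (\<forall>g\<in>L1_space M.
              integrable M (\<lambda>s. blinfun_apply (G s) (g s)) \<and>
              T g = (\<integral>s. blinfun_apply (G s) (g s) \<partial>M))"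
proof -
  interpret complete_measure M
    by fact
  have T: "T \<in> L1_dual M" and norm_T: "L1_dual_norm M T = 1" and Tf: "T f = L1_norm M f"
    using assms(6) by (auto simp: L1_support_functionals_def)
  obtain G where G: "strongly_measurable M G" "AE s in M. norm (G s) \<le> 1"
    and T_eq: "\<And>g. g \<in> L1_space M \<Longrightarrow> T g = (\<integral>s. blinfun_apply (G s) (g s) \<partial>M)"
    using L1_dual_representation[OF assms(1,3) T, of 1] L1_dual_norm_bound[OF T] norm_T by auto
  have "G \<in> Linf_space M"
    using G by (auto simp: Linf_space_def)
  moreover have "AE s in M. s \<in> space M - zero_set M f \<longrightarrow> G s \<in> support_functionals (f s)"
    using T_eq[OF assms(4)] Tf by (intro support_functionals_AE G assms(4)) simp
  ultimately show ?thesis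
    using T_eq integrable_blinfun_apply_bounded(1)[OF G] by blast
qed

end
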